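(* In the directed cut-matching game on $n$ vertices there is a cut player strategy such that, after $O(\log^2 n)$ rounds, the union of the directed matchings played by the matching player is an Eulerian graph with edge expansion $\Omega(\log n)$, regardless of the matching player's choices.
   Context: The directed cut-matching game on a vertex set $V$ with $|V|=n$ ($n$ even) starts from the empty graph. In each round the cut player chooses a bisection $(S,\overline S)$ of $V$, and the matching player then chooses a directed perfect matching between $S$ and $\overline S$, i.e. a directed graph whose edges go between $S$ and $\overline S$ and in which every vertex has in-degree exactly one and out-degree exactly one (hence it is Eulerian). The union of the matchings is the multigraph of all edges played. The edge expansion of a directed (multi)graph $H$ on $V$ is $\min_{\emptyset\neq S\subsetneq V}\frac{\min\{|\delta_H^+(S)|,|\delta_H^-(S)|\}}{\min\{|S|,|\overline S|\}}$, where $\delta^+_H(S)$ (resp. $\delta^-_H(S)$) is the multiset of edges of $H$ leaving (resp. entering) $S$. *)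

theory Defs
  imports Complex_Main "HOL-Library.Multiset"
begin

definition bisection :: "nat \<Rightarrow> nat set \<Rightarrow> bool" where
  "bisection n S \<longleftrightarrow> S \<subseteq> {..<n} \<and> 2 * card S = n"

text \<open>A directed perfect matching between S and its complement: every vertex v has
  exactly one out-edge (v, sigma v) and exactly one in-edge (sigma is a permutation of V),
  and every edge crosses the cut.\<close>
definition directed_matching :: "nat \<Rightarrow> nat set \<Rightarrow> (nat \<Rightarrow> nat) \<Rightarrow> bool" where
  "directed_matching n S \<sigma> \<longleftrightarrow>
     bij_betw \<sigma> {..<n} {..<n} \<and> (\<forall>v<n. v \<in> S \<longleftrightarrow> \<sigma> v \<notin> S)"

definition matching_graph :: "nat \<Rightarrow> (nat \<Rightarrow> nat) \<Rightarrow> (nat \<times> nat) multiset" where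
  "matching_graph n \<sigma> = image_mset (\<lambda>v. (v, \<sigma> v)) (mset_set {..<n})"

definition union_graph :: "nat \<Rightarrow> (nat \<Rightarrow> nat) list \<Rightarrow> (nat \<times> nat) multiset" where
  "union_graph n ms = sum_list (map (matching_graph n) ms)"

definition out_cut :: "(nat \<times> nat) multiset \<Rightarrow> nat set \<Rightarrow> nat" where
  "out_cut H S = size (filter_mset (\<lambda>e. fst e \<in> S \<and> snd e \<notin> S) H)"

definition in_cut :: "(nat \<times> nat) multiset \<Rightarrow> nat set \<Rightarrow> nat" where
  "in_cut H S = size (filter_mset (\<lambda>e. fst e \<notin> S \<and> snd e \<in> S) H)"

definition edge_expansion :: "nat \<Rightarrow> (nat \<times> nat) multiset \<Rightarrow> real" where
  "edge_expansion n H = Min {real (min (out_cut H S) (in_cut H S)) / real (min (card S) (card ({..<n} - S)))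
                             | S. S \<noteq> {} \<and> S \<subset> {..<n}}"

definition eulerian :: "nat \<Rightarrow> (nat \<times> nat) multiset \<Rightarrow> bool" where
  "eulerian n H \<longleftrightarrow> set_mset H \<subseteq> {..<n} \<times> {..<n} \<and>
     (\<forall>v<n. size (filter_mset (\<lambda>e. fst e = v) H) = size (filter_mset (\<lambda>e. snd e = v) H))"

end

theory Submission
  imports Defs
begin

text \<open>
  Every matching is a permutation, so as many edges leave a set as enter it and only out-cuts
  matter. These add up over rounds, so it suffices to reach expansion \<open>1/16\<close> in \<open>O(log n)\<close> rounds
  and to start afresh about \<open>log n\<close> times.

  Within a phase, suppose the graph has a balanced sparse cut \<open>S\<close>: \<open>n/4 \<le> |S| \<le> n/2\<close> and at most
  \<open>|S|/2\<close> edges leave \<open>S\<close>. The cut player plays a bisection containing \<open>S\<close>. Consider the lazy walk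
  that replaces the distribution \<open>P v\<close> at each vertex by the average of \<open>P v\<close> and \<open>P (\<sigma> v)\<close>. Only
  mass \<open>|S|/4\<close> can have crossed the cut in either direction, so the rows averaged at \<open>S\<close> are on
  average far apart and the total entropy grows by a constant times \<open>n\<close>. As it never exceeds
  \<open>n ln n\<close>, this happens \<open>O(log n)\<close> times.

  Once there is no such cut, the player plays a bisection containing a largest set \<open>S\<close> with
  \<open>|S| \<le> n/2\<close> and at most \<open>|S|/4\<close> leaving edges. A set \<open>U\<close> lying mostly in \<open>S\<close> is expanded by the new
  matching; otherwise \<open>U\<close> was already expanding, because \<open>S \<union> U\<close> is not sparse.
\<close>

section \<open>Edges leaving a set in a union of permutations\<close>

definition crossing :: "(nat \<Rightarrow> nat) list \<Rightarrow> nat set \<Rightarrow> nat" where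
  "crossing h U = (\<Sum>\<sigma>\<leftarrow>h. card {v\<in>U. \<sigma> v \<notin> U})"

lemma crossing_Nil [simp]: "crossing [] U = 0"
  and crossing_Cons [simp]: "crossing (\<sigma> # h) U = card {v\<in>U. \<sigma> v \<notin> U} + crossing h U"
  and crossing_append [simp]: "crossing (h @ h') U = crossing h U + crossing h' U"
  and crossing_empty [simp]: "crossing h {} = 0"
  by (simp_all add: crossing_def)

lemma crossing_rev [simp]: "crossing (rev h) U = crossing h U"
  by (induction h) auto

lemma crossing_Un_le:
  assumes "finite A" "finite B"
  shows "crossing h (A \<union> B) \<le> crossing h A + crossing h B"
proof (induction h)
  case (Cons \<sigma> h)
  have "card {v \<in> A \<union> B. \<sigma> v \<notin> A \<union> B} \<le> card ({v\<in>A. \<sigma> v \<notin> A} \<union> {v\<in>B. \<sigma> v \<notin> B})"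
    using assms by (intro card_mono) auto
  also have "\<dots> \<le> card {v\<in>A. \<sigma> v \<notin> A} + card {v\<in>B. \<sigma> v \<notin> B}"
    by (rule card_Un_le)
  finally show ?case using Cons by simp
qed simp

text \<open>Both \<open>U\<close> and its preimage under \<open>\<sigma>\<close> have
  \<open>card U\<close> elements. Removing from each the vertices of \<open>U\<close> that stay in
  \<open>U\<close> leaves the two sides.\<close>

lemma card_leaving_eq_entering:
  assumes "bij_betw \<sigma> V V" "U \<subseteq> V" "finite V"
  shows "card {v\<in>U. \<sigma> v \<notin> U} = card {v\<in>V - U. \<sigma> v \<in> U}"
proof -
  have fin: "finite U" using assms finite_subset by blast
  have "bij_betw \<sigma> {v\<in>V. \<sigma> v \<in> U} U"
    using assms unfolding bij_betw_def inj_on_def by auto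
  then have "card {v\<in>V. \<sigma> v \<in> U} = card U" by (rule bij_betw_same_card)
  moreover have "{v\<in>V. \<sigma> v \<in> U} = {v\<in>U. \<sigma> v \<in> U} \<union> {v\<in>V - U. \<sigma> v \<in> U}"
    using assms by auto
  moreover have "card ({v\<in>U. \<sigma> v \<in> U} \<union> {v\<in>V - U. \<sigma> v \<in> U})
      = card {v\<in>U. \<sigma> v \<in> U} + card {v\<in>V - U. \<sigma> v \<in> U}"
    using assms fin by (intro card_Un_disjoint) auto
  moreover have "U = {v\<in>U. \<sigma> v \<in> U} \<union> {v\<in>U. \<sigma> v \<notin> U}" by auto
  moreover have "card ({v\<in>U. \<sigma> v \<in> U} \<union> {v\<in>U. \<sigma> v \<notin> U})
      = card {v\<in>U. \<sigma> v \<in> U} + card {v\<in>U. \<sigma> v \<notin> U}"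
    using fin by (intro card_Un_disjoint) auto
  ultimately show ?thesis by simp
qed

lemma crossing_complement:
  assumes "\<forall>\<sigma>\<in>set h. bij_betw \<sigma> {..<n} {..<n}" "U \<subseteq> {..<n}"
  shows "crossing h ({..<n} - U) = crossing h U"
  using assms(1)
proof (induction h)
  case (Cons \<sigma> h)
  then have bij: "bij_betw \<sigma> {..<n} {..<n}" by simp
  then have "{v \<in> {..<n} - U. \<sigma> v \<notin> {..<n} - U} = {v \<in> {..<n} - U. \<sigma> v \<in> U}"
    using assms(2) by (auto simp: bij_betw_def)
  with card_leaving_eq_entering[OF bij assms(2)] Cons show ?case by simp
qed simp

lemma out_cut_union_graph:
  assumes "U \<subseteq> {..<n}"
  shows "out_cut (union_graph n h) U = crossing h U"
proof (induction h)
  case (Cons \<sigma> h)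
  have "{v \<in> {..<n}. v \<in> U \<and> \<sigma> v \<notin> U} = {v\<in>U. \<sigma> v \<notin> U}" using assms by auto
  with Cons show ?case
    by (simp add: out_cut_def union_graph_def matching_graph_def filter_mset_image_mset)
qed (simp add: out_cut_def union_graph_def)

lemma in_cut_union_graph:
  assumes "\<forall>\<sigma>\<in>set h. bij_betw \<sigma> {..<n} {..<n}" "U \<subseteq> {..<n}"
  shows "in_cut (union_graph n h) U = crossing h U"
  using assms(1)
proof (induction h)
  case (Cons \<sigma> h)
  then have bij: "bij_betw \<sigma> {..<n} {..<n}" by simp
  have "{v \<in> {..<n}. v \<notin> U \<and> \<sigma> v \<in> U} = {v\<in>{..<n} - U. \<sigma> v \<in> U}" by auto
  with card_leaving_eq_entering[OF bij assms(2)] Cons show ?case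
    by (simp add: in_cut_def union_graph_def matching_graph_def filter_mset_image_mset)
qed (simp add: in_cut_def union_graph_def)

lemma eulerian_union_graph:
  assumes "\<forall>\<sigma>\<in>set h. bij_betw \<sigma> {..<n} {..<n}"
  shows "eulerian n (union_graph n h)"
  using assms
proof (induction h)
  case Nil
  then show ?case by (simp add: eulerian_def union_graph_def)
next
  case (Cons \<sigma> h)
  then have bij: "bij_betw \<sigma> {..<n} {..<n}" by simp
  have "card {w \<in> {..<n}. w = v} = card {w \<in> {..<n}. \<sigma> w = v}" if "v < n" for v
  proof -
    have "v \<in> \<sigma> ` {..<n}" using bij that by (simp add: bij_betw_def)
    then obtain w where w: "w < n" "\<sigma> w = v" by auto
    then have "{w \<in> {..<n}. \<sigma> w = v} = {w}"
      using bij by (auto simp: bij_betw_def inj_on_def)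
    moreover have "{w \<in> {..<n}. w = v} = {v}" using that by auto
    ultimately show ?thesis by simp
  qed
  moreover have "\<sigma> w < n" if "w < n" for w
    using bij that by (auto simp: bij_betw_def)
  ultimately show ?case using Cons
    by (auto simp: eulerian_def union_graph_def matching_graph_def filter_mset_image_mset)
qed

text \<open>For permutations a set and its complement have equal crossings, so sets of at most half
  the vertices suffice. The product form admits the empty set and makes bounds add up under
  concatenation.\<close>

definition expanding :: "nat \<Rightarrow> (nat \<Rightarrow> nat) list \<Rightarrow> real \<Rightarrow> bool" where
  "expanding n h \<delta> \<longleftrightarrow>
     (\<forall>U. U \<subseteq> {..<n} \<and> 2 * card U \<le> n \<longrightarrow> \<delta> * card U \<le> crossing h U)"

lemma expanding_append:
  assumes "expanding n h \<delta>" "expanding n h' \<delta>'"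
  shows "expanding n (h @ h') (\<delta> + \<delta>')"
  unfolding expanding_def
proof (intro allI impI)
  fix U assume "U \<subseteq> {..<n} \<and> 2 * card U \<le> n"
  then have "\<delta> * card U \<le> crossing h U" "\<delta>' * card U \<le> crossing h' U"
    using assms by (auto simp: expanding_def)
  then show "(\<delta> + \<delta>') * card U \<le> crossing (h @ h') U" by (simp add: distrib_right)
qed

lemma edge_expansion_ge:
  assumes bij: "\<forall>\<sigma>\<in>set h. bij_betw \<sigma> {..<n} {..<n}"
    and exp: "expanding n h \<delta>" and n: "n \<ge> 2"
  shows "edge_expansion n (union_graph n h) \<ge> \<delta>"
proof -
  let ?r = "\<lambda>S. real (min (out_cut (union_graph n h) S) (in_cut (union_graph n h) S))
              / real (min (card S) (card ({..<n} - S)))"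
  have set: "{?r S | S. S \<noteq> {} \<and> S \<subset> {..<n}} = ?r ` {S. S \<noteq> {} \<and> S \<subset> {..<n}}" by auto
  have "finite {S. S \<noteq> {} \<and> S \<subset> {..<n}}"
    by (rule finite_subset[of _ "Pow {..<n}"]) auto
  \<comment> \<open>The minimum needs a nonempty family; \<open>n \<ge> 2\<close> makes
    \<open>{0}\<close> a proper subset.\<close>
  moreover have "{0} \<in> {S. S \<noteq> {} \<and> S \<subset> {..<n}}"
  proof -
    have "1 \<in> {..<n}" "1 \<notin> {0::nat}" "{0} \<subseteq> {..<n}" using n by auto
    then show ?thesis by blast
  qed
  moreover have "\<delta> \<le> ?r S" if S: "S \<noteq> {}" "S \<subset> {..<n}" for S
  proof -
    have sub: "S \<subseteq> {..<n}" and fin: "finite S" using S finite_subset by blast+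
    have card: "card ({..<n} - S) = n - card S" "card S \<le> n"
      using sub fin card_mono[of "{..<n}" S] by (auto simp: card_Diff_subset)
    have pos: "card S > 0" "card ({..<n} - S) > 0"
      using S fin by (auto simp: card_gt_0_iff)
    have "\<delta> * min (card S) (card ({..<n} - S)) \<le> crossing h S"
    proof (cases "2 * card S \<le> n")
      case True
      then show ?thesis using exp sub card by (auto simp: expanding_def min_def)
    next
      case False
      then have "2 * card ({..<n} - S) \<le> n" using card by simp
      then have "\<delta> * card ({..<n} - S) \<le> crossing h ({..<n} - S)"
        by (rule exp[unfolded expanding_def, rule_format, OF conjI[OF Diff_subset]])
      then show ?thesis using crossing_complement[OF bij sub] False card by (auto simp: min_def)
    qed
    then show ?thesis
      using pos by (simp add: out_cut_union_graph[OF sub] in_cut_union_graph[OF bij sub] field_simps)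
  qed
  ultimately show ?thesis unfolding edge_expansion_def set by (subst Min_ge_iff) auto
qed

section \<open>Entropy of the lazy walk\<close>

text \<open>The history is listed with the most recent matching first, so that each new matching
  averages the current rows.\<close>
primrec walk :: "(nat \<Rightarrow> nat) list \<Rightarrow> nat \<Rightarrow> nat \<Rightarrow> real" where
  "walk [] v u = of_bool (v = u)"
| "walk (\<sigma> # h) v u = (walk h v u + walk h (\<sigma> v) u) / 2"

lemma walk_nonneg: "walk h v u \<ge> 0"
  by (induction h arbitrary: v) auto

lemma walk_row_sum:
  assumes "\<forall>\<sigma>\<in>set h. \<sigma> ` {..<n} \<subseteq> {..<n}" "v < n"
  shows "(\<Sum>u<n. walk h v u) = 1"
  using assms
proof (induction h arbitrary: v)
  case Nil
  then show ?case by (simp add: of_bool_def)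
next
  case (Cons \<sigma> h)
  then have "\<sigma> v < n" by auto
  with Cons show ?case by (simp add: sum.distrib flip: sum_divide_distrib)
qed

lemma walk_mass_le_1:
  assumes "\<forall>\<sigma>\<in>set h. \<sigma> ` {..<n} \<subseteq> {..<n}" "v < n" "W \<subseteq> {..<n}"
  shows "(\<Sum>u\<in>W. walk h v u) \<le> 1"
proof -
  have "(\<Sum>u\<in>W. walk h v u) \<le> (\<Sum>u<n. walk h v u)"
    using assms(3) by (intro sum_mono2) (auto simp: walk_nonneg)
  then show ?thesis using walk_row_sum[OF assms(1,2)] by simp
qed

text \<open>A new matching averages the escaped mass with the mass that the rows at
  \<open>\<sigma> v\<close> have outside \<open>U\<close>. By injectivity, partners inside
  \<open>U\<close> contribute at most the old escaped mass; each partner outside contributes at most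
  1. So every crossing edge adds at most 1/2.\<close>

lemma walk_escaping_mass:
  assumes "\<forall>\<sigma>\<in>set h. bij_betw \<sigma> {..<n} {..<n}" "U \<subseteq> {..<n}"
  shows "2 * (\<Sum>v\<in>U. \<Sum>u\<in>{..<n} - U. walk h v u) \<le> crossing h U"
  using assms(1)
proof (induction h)
  case Nil
  have "(\<Sum>v\<in>U. \<Sum>u\<in>{..<n} - U. walk [] v u) = 0"
    by (intro sum.neutral ballI) auto
  then show ?case by simp
next
  case (Cons \<sigma> h)
  let ?W = "{..<n} - U"
  let ?q = "\<lambda>v. \<Sum>u\<in>?W. walk h v u"
  have fin: "finite U" using assms(2) finite_subset by blast
  have bij: "bij_betw \<sigma> {..<n} {..<n}" and inj: "inj_on \<sigma> {..<n}" and im: "\<sigma> ` {..<n} = {..<n}"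
    using Cons.prems by (auto simp: bij_betw_def)
  have maps: "\<forall>\<sigma>\<in>set h. \<sigma> ` {..<n} \<subseteq> {..<n}" using Cons.prems by (auto simp: bij_betw_def)
  have "(\<Sum>v\<in>U. ?q (\<sigma> v)) = (\<Sum>v\<in>{v\<in>U. \<sigma> v \<in> U}. ?q (\<sigma> v)) + (\<Sum>v\<in>{v\<in>U. \<sigma> v \<notin> U}. ?q (\<sigma> v))"
    using fin by (subst sum.union_disjoint[symmetric]) (auto intro!: sum.cong)
  also have "(\<Sum>v\<in>{v\<in>U. \<sigma> v \<in> U}. ?q (\<sigma> v)) = (\<Sum>w\<in>\<sigma> ` {v\<in>U. \<sigma> v \<in> U}. ?q w)"
    using inj assms(2) by (subst sum.reindex) (auto intro: inj_on_subset)
  also have "\<dots> \<le> (\<Sum>w\<in>U. ?q w)"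
    using fin by (intro sum_mono2) (auto intro: sum_nonneg walk_nonneg)
  also have "(\<Sum>v\<in>{v\<in>U. \<sigma> v \<notin> U}. ?q (\<sigma> v)) \<le> (\<Sum>v\<in>{v\<in>U. \<sigma> v \<notin> U}. 1)"
    using im assms(2) by (intro sum_mono walk_mass_le_1[OF maps]) auto
  finally have "(\<Sum>v\<in>U. ?q (\<sigma> v)) \<le> (\<Sum>v\<in>U. ?q v) + card {v\<in>U. \<sigma> v \<notin> U}" by simp
  moreover have "2 * (\<Sum>v\<in>U. \<Sum>u\<in>?W. walk (\<sigma> # h) v u) = (\<Sum>v\<in>U. ?q v) + (\<Sum>v\<in>U. ?q (\<sigma> v))"
    by (simp add: sum.distrib flip: sum_divide_distrib)
  ultimately show ?case using Cons by simp
qed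

text \<open>Minus the total entropy of the rows, so progress of the cut player is a
  decrease.\<close>

definition potential :: "nat \<Rightarrow> (nat \<Rightarrow> nat) list \<Rightarrow> real" where
  "potential n h = (\<Sum>v<n. \<Sum>u<n. walk h v u * ln (walk h v u))"

text \<open>The tangent bound \<open>ln t \<le> t - 1\<close> at \<open>t = a * m / x\<close>,
  multiplied by \<open>x\<close>.\<close>

lemma mult_ln_ge:
  fixes x a m :: real
  assumes "x \<ge> 0" "a > 0" "m > 0"
  shows "x * ln x \<ge> x * ln m + x * ln a + x - a * m"
proof (cases "x = 0")
  case False
  with assms have x: "x > 0" by simp
  have "ln (a * m / x) \<le> a * m / x - 1" using assms x by (intro ln_le_minus_one) auto
  then have "x * ln (a * m / x) \<le> x * (a * m / x - 1)" using x by (simp add: mult_left_mono)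
  then show ?thesis using assms x by (simp add: ln_div ln_mult algebra_simps)
qed (use assms in auto)

text \<open>Being linear in \<open>x\<close> and \<open>y\<close>, this bound sums over a row to the masses of \<open>S\<close> and its
  complement when \<open>(a, b)\<close> is \<open>(3/2, 1/2)\<close> on \<open>S\<close> and \<open>(1/2, 3/2)\<close> off \<open>S\<close>.\<close>
lemma entropy_gap_ge:
  fixes x y a b :: real
  assumes "x \<ge> 0" "y \<ge> 0" "a > 0" "b > 0" "a + b = 2"
  shows "x * ln x + y * ln y - 2 * ((x + y) / 2 * ln ((x + y) / 2)) \<ge> x * ln a + y * ln b"
proof (cases "x + y = 0")
  case True
  then show ?thesis using assms by (simp add: add_nonneg_eq_0_iff)
next
  case False
  define m where "m = (x + y) / 2"
  have m: "m > 0" using False assms by (simp add: m_def)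
  \<comment> \<open>Since \<open>a + b = 2\<close>, the non-logarithmic terms of the two tangent
    bounds cancel.\<close>
  have "a * m + b * m = (a + b) * m" by (simp add: distrib_right)
  then have "a * m + b * m = x + y" using assms(5) by (simp add: m_def)
  moreover have "x * ln m + y * ln m = 2 * (m * ln m)" by (simp add: m_def flip: distrib_right)
  ultimately show ?thesis
    using mult_ln_ge[OF assms(1,3) m] mult_ln_ge[OF assms(2,4) m] by (simp add: m_def[symmetric])
qed

lemma potential_Nil: "potential n [] = 0"
  by (simp add: potential_def)

text \<open>Each row is a distribution on \<open>n\<close> points; comparison with the uniform
  weight \<open>1 / n\<close> bounds its entropy by \<open>ln n\<close>.\<close>

lemma potential_ge:
  assumes "\<forall>\<sigma>\<in>set h. \<sigma> ` {..<n} \<subseteq> {..<n}" "n > 0"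
  shows "potential n h \<ge> - (n * ln n)"
proof -
  have "(\<Sum>u<n. walk h v u * ln (walk h v u)) \<ge> - ln n" if "v < n" for v
  proof -
    have "(\<Sum>u<n. walk h v u * ln (walk h v u)) \<ge> (\<Sum>u<n. walk h v u * (1 - ln n) - 1 / n)"
    proof (rule sum_mono)
      fix u
      show "walk h v u * (1 - ln n) - 1 / n \<le> walk h v u * ln (walk h v u)"
        using mult_ln_ge[OF walk_nonneg[of h v u], of "1 / real n" 1] assms(2)
        by (simp add: ln_div algebra_simps)
    qed
    also have "(\<Sum>u<n. walk h v u * (1 - ln n) - 1 / n) = - ln n"
      using walk_row_sum[OF assms(1) that] assms(2)
      by (simp add: sum_subtractf flip: sum_distrib_right)
    finally show ?thesis .
  qed
  then have "potential n h \<ge> (\<Sum>v<n. - ln n)"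
    unfolding potential_def by (intro sum_mono) auto
  then show ?thesis by simp
qed

lemma ln_27_16_ge: "ln (27 / 16 :: real) \<ge> 2 / 5"
  using ln_le_minus_one[of "16 / 27 :: real"] by (simp add: ln_div)

lemma potential_decrease:
  assumes bij: "\<forall>\<sigma>\<in>set (\<sigma> # h). bij_betw \<sigma> {..<n} {..<n}"
    and S: "S \<subseteq> {..<n}" "\<forall>v\<in>S. \<sigma> v \<notin> S" "2 * crossing h S \<le> card S"
  shows "potential n (\<sigma> # h) \<le> potential n h - card S / 10"
proof -
  let ?V = "{..<n}"
  let ?f = "\<lambda>x::real. x * ln x"
  define J where "J v u = ?f (walk h v u) + ?f (walk h (\<sigma> v) u) - 2 * ?f (walk (\<sigma> # h) v u)" for v u
  have maps: "\<forall>\<sigma>\<in>set h. \<sigma> ` {..<n} \<subseteq> {..<n}" and bij\<sigma>: "bij_betw \<sigma> ?V ?V"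
    and bijh: "\<forall>\<sigma>\<in>set h. bij_betw \<sigma> {..<n} {..<n}"
    and \<sigma>V: "\<And>v. v < n \<Longrightarrow> \<sigma> v < n"
    using bij by (auto simp: bij_betw_def)

  have J: "J v u \<ge> walk h v u * ln a + walk h (\<sigma> v) u * ln b" if "a > 0" "b > 0" "a + b = 2" for v u a b
    unfolding J_def using entropy_gap_ge[OF walk_nonneg walk_nonneg that] by simp
  \<comment> \<open>Equal weights make the bound vanish; this later lets the sum over
    \<open>S\<close> grow to all vertices.\<close>
  have J0: "J v u \<ge> 0" for v u using J[of 1 1] by simp
  \<comment> \<open>As \<open>\<sigma>\<close> is a permutation, its partners run through all rows
    once more, whence the factor 2 in \<open>gap\<close>.\<close>
  have "(\<Sum>v<n. \<Sum>u<n. ?f (walk h (\<sigma> v) u)) = potential n h"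
    unfolding potential_def by (rule sum.reindex_bij_betw[OF bij\<sigma>])
  then have gap: "(\<Sum>v<n. \<Sum>u<n. J v u) = 2 * (potential n h - potential n (\<sigma> # h))"
    by (simp add: J_def potential_def sum.distrib sum_subtractf sum_distrib_left del: walk.simps)
  let ?in = "\<lambda>v. \<Sum>u\<in>S. walk h v u" and ?out = "\<lambda>v. \<Sum>u\<in>?V - S. walk h v u"
  have in_out: "?in v + ?out v = 1" if "v < n" for v
    using walk_row_sum[OF maps that] sum.subset_diff[OF S(1), of "walk h v"] by simp
  \<comment> \<open>The row at \<open>v\<close> should lie mostly in \<open>S\<close> and the row at
    \<open>\<sigma> v\<close> mostly outside. Well-placed mass gets weight 3/2, misplaced mass
    \<open>?out v + ?in (\<sigma> v)\<close> gets 1/2.\<close>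
  have row: "(\<Sum>u<n. J v u) \<ge> 2 * ln (3/2) - ln 3 * (?out v + ?in (\<sigma> v))" if v: "v \<in> S" for v
  proof -
    have vn: "v < n" "\<sigma> v < n" using v S \<sigma>V by auto
    have "(\<Sum>u<n. J v u) = (\<Sum>u\<in>S. J v u) + (\<Sum>u\<in>?V - S. J v u)"
      using sum.subset_diff[OF S(1), of "J v"] by simp
    also have "\<dots> \<ge> (\<Sum>u\<in>S. walk h v u * ln (3/2) + walk h (\<sigma> v) u * ln (1/2))
                  + (\<Sum>u\<in>?V - S. walk h v u * ln (1/2) + walk h (\<sigma> v) u * ln (3/2))"
      by (intro add_mono sum_mono J) auto
    also have "(\<Sum>u\<in>S. walk h v u * ln (3/2) + walk h (\<sigma> v) u * ln (1/2))
                  + (\<Sum>u\<in>?V - S. walk h v u * ln (1/2) + walk h (\<sigma> v) u * ln (3/2))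
      = (?in v + ?out (\<sigma> v)) * ln (3/2) + (?out v + ?in (\<sigma> v)) * ln (1/2)"
      by (simp add: sum.distrib distrib_right flip: sum_distrib_right)
    also have "\<dots> = 2 * ln (3/2) - (ln (3/2) - ln (1/2)) * (?out v + ?in (\<sigma> v))"
      using in_out[OF vn(1)] in_out[OF vn(2)] by algebra
    also have "ln (3/2) - ln (1/2) = ln (3::real)" by (simp add: ln_div)
    finally show ?thesis .
  qed
  \<comment> \<open>The partners of \<open>S\<close> are distinct vertices of the complement, so
    their mass in \<open>S\<close> is bounded by what escapes from the complement, at most
    \<open>crossing h S / 2\<close>.\<close>
  have "(\<Sum>v\<in>S. ?in (\<sigma> v)) = (\<Sum>w\<in>\<sigma> ` S. ?in w)"
    using bij\<sigma> S by (subst sum.reindex) (auto simp: bij_betw_def intro: inj_on_subset)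
  also have "\<dots> \<le> (\<Sum>w\<in>?V - S. ?in w)"
    using S \<sigma>V by (intro sum_mono2) (auto intro: sum_nonneg walk_nonneg)
  also have "2 * (\<Sum>w\<in>?V - S. ?in w) \<le> crossing h S"
    using walk_escaping_mass[OF bijh, of "?V - S"] crossing_complement[OF bijh S(1)] S(1)
    by (simp add: double_diff)
  finally have "2 * (\<Sum>v\<in>S. ?in (\<sigma> v)) \<le> crossing h S" by simp
  with walk_escaping_mass[OF bijh S(1)] S(3)
  have "(\<Sum>v\<in>S. ?out v + ?in (\<sigma> v)) \<le> card S / 2"
    by (simp add: sum.distrib)
  then have mass: "ln 3 * (\<Sum>v\<in>S. ?out v + ?in (\<sigma> v)) \<le> ln 3 * (card S / 2)"
    by (intro mult_left_mono) auto
  \<comment> \<open>With misplaced mass at most 1/2 per vertex of \<open>S\<close> on average, the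
    gain per vertex is \<open>2 * ln (3/2) - ln 3 / 2\<close>, which is
    \<open>ln (27/16) / 2\<close>.\<close>
  have "card S / 5 \<le> card S * (2 * ln (3/2)) - ln 3 * (card S / 2)"
  proof -
    have "ln (27/16 :: real) = 3 * ln 3 - 4 * ln 2"
      using ln_realpow[of 3 3] ln_realpow[of 2 4] by (simp add: ln_div)
    then have "2 * ln (3/2) - ln 3 / 2 \<ge> (1/5 :: real)"
      using ln_27_16_ge by (simp add: ln_div)
    then have "card S * (2 * ln (3/2) - ln 3 / 2) \<ge> card S * (1/5 :: real)"
      by (intro mult_left_mono) auto
    then show ?thesis by (simp add: algebra_simps)
  qed
  also have "\<dots> \<le> card S * (2 * ln (3/2)) - ln 3 * (\<Sum>v\<in>S. ?out v + ?in (\<sigma> v))"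
    by (rule diff_left_mono[OF mass])
  also have "\<dots> = (\<Sum>v\<in>S. 2 * ln (3/2) - ln 3 * (?out v + ?in (\<sigma> v)))"
    by (simp add: sum_subtractf sum_distrib_left)
  also have "\<dots> \<le> (\<Sum>v\<in>S. \<Sum>u<n. J v u)"
    using row by (intro sum_mono) auto
  also have "\<dots> \<le> (\<Sum>v<n. \<Sum>u<n. J v u)"
    using S J0 by (intro sum_mono2) (auto intro: sum_nonneg)
  also have "\<dots> = 2 * (potential n h - potential n (\<sigma> # h))" by (rule gap)
  finally show ?thesis by simp
qed

section \<open>The cut player\<close>

definition balanced_sparse :: "nat \<Rightarrow> (nat \<Rightarrow> nat) list \<Rightarrow> nat set \<Rightarrow> bool" where
  "balanced_sparse n h S \<longleftrightarrow>
     S \<subseteq> {..<n} \<and> n \<le> 4 * card S \<and> 2 * card S \<le> n \<and> 2 * crossing h S \<le> card S"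

text \<open>The threshold 1/4, stricter than the 1/2 in \<open>balanced_sparse\<close>, leaves slack
  when the crossings of \<open>S\<close> are subtracted from those of
  \<open>S \<union> U\<close>.\<close>

definition sparse :: "nat \<Rightarrow> (nat \<Rightarrow> nat) list \<Rightarrow> nat set \<Rightarrow> bool" where
  "sparse n h S \<longleftrightarrow> S \<subseteq> {..<n} \<and> 2 * card S \<le> n \<and> 4 * crossing h S \<le> card S"

text \<open>Maximality in the second case prevents \<open>S \<union> U\<close> from being sparse
  whenever \<open>U\<close> adds vertices to \<open>S\<close>.\<close>

definition target :: "nat \<Rightarrow> (nat \<Rightarrow> nat) list \<Rightarrow> nat set \<Rightarrow> bool" where
  "target n h S \<longleftrightarrow> balanced_sparse n h S \<or>
     (\<nexists>S'. balanced_sparse n h S') \<and> sparse n h S \<and> (\<forall>S'. sparse n h S' \<longrightarrow> card S' \<le> card S)"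

lemma ex_target: "\<exists>S. target n h S"
proof (cases "\<exists>S. balanced_sparse n h S")
  case False
  have "sparse n h {}" by (simp add: sparse_def)
  moreover have "card S \<le> n" if "sparse n h S" for S
    using that by (simp add: sparse_def)
  ultimately obtain S where "sparse n h S" "\<forall>S'. sparse n h S' \<longrightarrow> card S' \<le> card S"
    using ex_has_greatest_nat[of "sparse n h" "{}" card "Suc n"] by (auto simp: less_Suc_eq_le)
  with False show ?thesis by (auto simp: target_def)
qed (auto simp: target_def)

lemma bisection_extends:
  assumes "S \<subseteq> {..<n}" "2 * card S \<le> n" "even n"
  shows "\<exists>A. bisection n A \<and> S \<subseteq> A"
proof -
  have "card S \<le> n div 2" "n div 2 \<le> card {..<n}" using assms by auto
  then obtain A where "S \<subseteq> A" "A \<subseteq> {..<n}" "card A = n div 2"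
    using exists_subset_between[of S "n div 2" "{..<n}"] assms(1) by auto
  then show ?thesis using assms(3) by (auto simp: bisection_def)
qed

lemma ex_cut_strategy:
  assumes "even n"
  shows "\<exists>strat. \<forall>h. bisection n (strat h) \<and> (\<exists>S. target n h S \<and> S \<subseteq> strat h)"
proof -
  have "\<exists>A. bisection n A \<and> (\<exists>S. target n h S \<and> S \<subseteq> A)" for h
  proof -
    obtain S where S: "target n h S" using ex_target by blast
    then have "S \<subseteq> {..<n}" "2 * card S \<le> n"
      by (auto simp: target_def sparse_def balanced_sparse_def)
    with bisection_extends[OF _ _ assms] S show ?thesis by blast
  qed
  then show ?thesis by metis
qed

lemma expanding_after_unbalanced_round:
  assumes bij: "\<forall>\<sigma>\<in>set (\<sigma> # h). bij_betw \<sigma> {..<n} {..<n}"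
    and none: "\<nexists>S'. balanced_sparse n h S'"
    and S: "sparse n h S" "\<forall>S'. sparse n h S' \<longrightarrow> card S' \<le> card S"
    and \<sigma>: "\<forall>v\<in>S. \<sigma> v \<notin> S"
  shows "expanding n (\<sigma> # h) (1/16)"
  unfolding expanding_def
proof (intro allI impI, elim conjE)
  fix U assume U: "U \<subseteq> {..<n}" "2 * card U \<le> n"
  have SV: "S \<subseteq> {..<n}" and Sn: "2 * card S \<le> n" and Sc: "4 * crossing h S \<le> card S"
    using S(1) by (auto simp: sparse_def)
  have fin: "finite S" "finite U" using SV U finite_subset by blast+
  \<comment> \<open>From size \<open>n/4\<close> on, a sparse set would be balanced sparse.\<close>
  have small: "4 * card S < n"
  proof (rule ccontr)
    assume "\<not> ?thesis"
    then have "balanced_sparse n h S" using SV Sn Sc by (simp add: balanced_sparse_def)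
    then show False using none by blast
  qed
  have sub: "crossing h (S \<union> U) \<le> crossing h S + crossing h U"
    using crossing_Un_le fin by blast
  have cardU: "card U = card (U \<inter> S) + card (U - S)"
    using fin by (metis card_Int_Diff)
  have cardSU: "card (S \<union> U) = card S + card (U - S)"
    using fin card_Un_disjoint[of S "U - S"] by simp
  have "card U \<le> 16 * (card {v\<in>U. \<sigma> v \<notin> U} + crossing h U)"
  proof (cases "4 * card (U - S) < card U")
    case True
    \<comment> \<open>Vertices of \<open>U \<inter> S\<close> matched within \<open>U\<close> have
      distinct partners in \<open>U - S\<close>, so they are fewer than a quarter of
      \<open>U\<close>. Over half of \<open>U\<close> is therefore matched out of
      \<open>U\<close>.\<close>
    have "card {v\<in>U \<inter> S. \<sigma> v \<in> U} = card (\<sigma> ` {v\<in>U \<inter> S. \<sigma> v \<in> U})"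
      using bij U by (subst card_image) (auto simp: bij_betw_def intro: inj_on_subset)
    also have "\<dots> \<le> card (U - S)" using fin \<sigma> by (intro card_mono) auto
    finally have "card {v\<in>U \<inter> S. \<sigma> v \<in> U} \<le> card (U - S)" .
    moreover have "card (U \<inter> S) \<le> card ({v\<in>U \<inter> S. \<sigma> v \<in> U} \<union> {v\<in>U. \<sigma> v \<notin> U})"
      using fin by (intro card_mono) auto
    moreover have "card ({v\<in>U \<inter> S. \<sigma> v \<in> U} \<union> {v\<in>U. \<sigma> v \<notin> U})
        \<le> card {v\<in>U \<inter> S. \<sigma> v \<in> U} + card {v\<in>U. \<sigma> v \<notin> U}" by (rule card_Un_le)
    ultimately have "card U \<le> 2 * card {v\<in>U. \<sigma> v \<notin> U}" using True cardU by linarith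
    then show ?thesis by simp
  next
    case False
    show ?thesis
    proof (cases "2 * card (S \<union> U) \<le> n")
      case True
      show ?thesis
      proof (cases "U - S = {}")
        case True
        then have "card (U - S) = 0" by (simp only: card.empty)
        then show ?thesis using False by linarith
      next
        case ne: False
        then have "card (U - S) > 0" using fin by (simp add: card_gt_0_iff)
        \<comment> \<open>By maximality of \<open>S\<close>. Subtracting the crossings of
          \<open>S\<close> leaves \<open>crossing h U\<close> above \<open>card (U - S) / 4\<close>,
          hence above \<open>card U / 16\<close>.\<close>
        then have "\<not> sparse n h (S \<union> U)" using S(2) cardSU by fastforce
        then have "4 * crossing h (S \<union> U) > card (S \<union> U)"
          using True SV U by (auto simp: sparse_def)
        then have "card U \<le> 16 * crossing h U" using False sub Sc cardSU by linarith
        then show ?thesis by simp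
      qed
    next
      case big: False
      \<comment> \<open>As \<open>card S < n/4\<close> and \<open>card U \<le> n/2\<close>, this
        complement has between \<open>n/4\<close> and \<open>n/2\<close> vertices. Not being
        balanced sparse, it has over \<open>n/8\<close> crossings, of which \<open>S\<close>
        accounts for fewer than \<open>n/16\<close>.\<close>
      let ?W = "{..<n} - (S \<union> U)"
      have "card (S \<union> U) \<le> card S + card U" by (rule card_Un_le)
      moreover have "card ?W = n - card (S \<union> U)"
        using SV U fin by (subst card_Diff_subset) auto
      ultimately have W: "n \<le> 4 * card ?W" "2 * card ?W \<le> n" using big small U by linarith+
      have "2 * crossing h ?W > card ?W"
        using none W unfolding balanced_sparse_def by (meson Diff_subset not_le)
      moreover have "crossing h ?W = crossing h (S \<union> U)"
        using bij SV U by (intro crossing_complement) auto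
      ultimately have "card U \<le> 16 * crossing h U" using sub Sc W small U by linarith
      then show ?thesis by simp
    qed
  qed
  then show "1/16 * real (card U) \<le> real (crossing (\<sigma> # h) U)" by simp
qed

lemma expanding_rev: "expanding n (rev h) \<delta> = expanding n h \<delta>"
  by (simp add: expanding_def)

lemma expanding_append_right: "expanding n h \<delta> \<Longrightarrow> expanding n (h @ h') \<delta>"
  using expanding_append[of n h \<delta> h' 0] by (simp add: expanding_def)

text \<open>If expansion were never reached, every round would have a balanced sparse target of size
  at least \<open>n/4\<close> and lower the potential by \<open>n/40\<close>. More than
  \<open>40 * ln n\<close> rounds would push it below \<open>-(n * ln n)\<close>.\<close>

lemma cut_strategy_expanding:
  assumes n: "n > 0" and T: "real T > 40 * ln n"
    and strat: "\<forall>h. \<exists>S. target n h S \<and> S \<subseteq> strat h"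
    and len: "length ms = T"
    and ms: "\<forall>i<T. directed_matching n (strat (take i ms)) (ms ! i)"
  shows "expanding n ms (1/16)"
proof (rule ccontr)
  assume not: "\<not> expanding n ms (1/16)"
  have bij: "\<forall>\<sigma>\<in>set ms. bij_betw \<sigma> {..<n} {..<n}"
    using ms len by (auto simp: in_set_conv_nth directed_matching_def)
  \<comment> \<open>The game appends matchings, whereas \<open>walk\<close> expects the latest one
    first; hence \<open>rev\<close>.\<close>
  have "potential n (rev (take i ms)) \<le> - (i * (n / 40))" if "i \<le> T" for i
    using that
  proof (induction i)
    case 0
    then show ?case by (simp add: potential_Nil)
  next
    case (Suc i)
    let ?h = "take i ms" and ?\<sigma> = "ms ! i"
    have take: "take (Suc i) ms = ?h @ [?\<sigma>]" using Suc len by (simp add: take_Suc_conv_app_nth)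
    have bij': "\<forall>\<sigma>\<in>set (?\<sigma> # rev ?h). bij_betw \<sigma> {..<n} {..<n}"
      using bij Suc len by (auto dest: in_set_takeD)
    obtain S where S: "target n ?h S" "S \<subseteq> strat ?h" using strat by blast
    have SV: "S \<subseteq> {..<n}" using S by (auto simp: target_def sparse_def balanced_sparse_def)
    have cross: "\<forall>v\<in>S. ?\<sigma> v \<notin> S"
      using ms Suc S SV unfolding directed_matching_def by (meson Suc_le_lessD lessThan_iff subsetD)
    have rev: "balanced_sparse n (rev ?h) = balanced_sparse n ?h" "sparse n (rev ?h) = sparse n ?h"
      by (auto simp: balanced_sparse_def sparse_def fun_eq_iff)
    show ?case
    proof (cases "balanced_sparse n ?h S")
      case True
      then have "potential n (?\<sigma> # rev ?h) \<le> potential n (rev ?h) - card S / 10"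
        by (intro potential_decrease[OF bij' SV cross]) (simp add: balanced_sparse_def)
      moreover have "n / 4 \<le> card S" using True by (simp add: balanced_sparse_def)
      moreover have "real (Suc i) * (n / 40) = i * (n / 40) + n / 40" by (simp add: distrib_right)
      moreover have "potential n (rev ?h) \<le> - (i * (n / 40))" using Suc by simp
      ultimately have "potential n (?\<sigma> # rev ?h) \<le> - (real (Suc i) * (n / 40))" by linarith
      then show ?thesis by (simp only: take rev_append rev.simps append.simps)
    next
      case False
      \<comment> \<open>Expansion reached in mid-phase persists, since later matchings only add
        edges; this contradicts \<open>not\<close>.\<close>
      then have "expanding n (?\<sigma> # rev ?h) (1/16)"
        using S cross by (intro expanding_after_unbalanced_round[OF bij']) (auto simp: target_def rev)
      then have "expanding n (take (Suc i) ms) (1/16)"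
        using take expanding_rev[of n "take (Suc i) ms"] by simp
      then have "expanding n (take (Suc i) ms @ drop (Suc i) ms) (1/16)"
        by (rule expanding_append_right)
      then show ?thesis using not by simp
    qed
  qed
  then have "potential n (rev (take T ms)) \<le> - (T * (n / 40))" by simp
  moreover have "potential n (rev (take T ms)) \<ge> - (n * ln n)"
    using bij n by (intro potential_ge) (auto dest!: in_set_takeD simp: bij_betw_def)
  ultimately have "n * (T / 40) \<le> n * ln n" by (simp add: mult.commute)
  then show False using n T by simp
qed

lemma expanding_blocks:
  assumes "\<forall>j<K. expanding n (take T (drop (j * T) ms)) \<delta>" "length ms = K * T"
  shows "expanding n ms (K * \<delta>)"
  using assms
proof (induction K arbitrary: ms)
  case 0
  then show ?case by (simp add: expanding_def)
next
  case (Suc K)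
  have "expanding n (take T (drop (j * T) (drop T ms))) \<delta>" if "j < K" for j
    using Suc.prems(1)[rule_format, of "Suc j"] that by (simp add: add.commute)
  then have "expanding n (drop T ms) (K * \<delta>)" using Suc by simp
  moreover have "expanding n (take T ms) \<delta>" using Suc.prems(1)[rule_format, of 0] by simp
  ultimately have "expanding n (take T ms @ drop T ms) (\<delta> + K * \<delta>)" by (intro expanding_append)
  then show ?case by (simp add: algebra_simps)
qed

text \<open>Dropping \<open>length h div T * T\<close> matchings forgets all completed phases, so
  each block of \<open>T\<close> rounds is played as if from the empty graph.\<close>

lemma repeated_strategy_expanding:
  assumes T: "T > 0"
    and phase: "\<And>ms. length ms = T \<Longrightarrow>
      \<forall>i<T. directed_matching n (strat (take i ms)) (ms ! i) \<Longrightarrow> expanding n ms \<delta>"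
    and len: "length ms = K * T"
    and ms: "\<forall>i<K * T. directed_matching n
      ((\<lambda>h. strat (drop (length h div T * T) h)) (take i ms)) (ms ! i)"
  shows "expanding n ms (K * \<delta>)"
proof (rule expanding_blocks[OF _ len], intro allI impI)
  fix j assume "j < K"
  then have "Suc j * T \<le> K * T" by (intro mult_le_mono1) simp
  then have le: "j * T + T \<le> K * T" by (simp add: add.commute)
  let ?b = "take T (drop (j * T) ms)"
  show "expanding n ?b \<delta>"
  proof (rule phase, goal_cases)
    case 1
    show ?case using le len by simp
  next
    case 2
    show ?case
    proof (intro allI impI)
      fix i assume i: "i < T"
      have "length (take (j * T + i) ms) = j * T + i" using i le len by simp
      moreover have "(j * T + i) div T * T = j * T" using i T by simp
      moreover have "drop (j * T) (take (j * T + i) ms) = take i ?b"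
        using i by (simp add: drop_take min_def)
      moreover have "?b ! i = ms ! (j * T + i)"
        using i le len nth_drop[of "j * T" ms i] by (metis add_leD1 nth_take)
      ultimately show "directed_matching n (strat (take i ?b)) (?b ! i)"
        using ms[rule_format, of "j * T + i"] i le by simp
    qed
  qed
qed

theorem mainTheorem5:
  shows "\<exists>c1 c2 :: real. \<exists>n0 :: nat. c1 > 0 \<and> c2 > 0 \<and>
    (\<forall>n::nat. n \<ge> n0 \<and> even n \<longrightarrow>
      (\<exists>T::nat. real T \<le> c1 * (ln (real n))^2 \<and>
        (\<exists>strat :: (nat \<Rightarrow> nat) list \<Rightarrow> nat set.
           (\<forall>h. bisection n (strat h)) \<and>
           (\<forall>ms :: (nat \<Rightarrow> nat) list.
              length ms = T \<and> (\<forall>i<T. directed_matching n (strat (take i ms)) (ms ! i)) \<longrightarrow>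
              eulerian n (union_graph n ms) \<and>
              edge_expansion n (union_graph n ms) \<ge> c2 * ln (real n)))))"
proof (rule exI[of _ 82], rule exI[of _ "1/16"], rule exI[of _ 3], intro conjI allI impI; (elim conjE)?)
  fix n :: nat assume n: "n \<ge> 3" "even n"
  define L where "L = ln (real n)"
  \<comment> \<open>A phase needs strictly more than \<open>40 * L\<close> rounds, and
    \<open>K \<ge> L\<close> phases give expansion \<open>L/16\<close>. For
    \<open>n \<ge> 3\<close>, \<open>L \<ge> 1\<close> absorbs the rounding: at most
    \<open>41 * L\<close> rounds times \<open>2 * L\<close> phases, whence 82.\<close>
  define T where "T = nat \<lfloor>40 * L\<rfloor> + 1"
  define K where "K = nat \<lceil>L\<rceil>"
  have "exp 1 \<le> real n" using exp_le n by linarith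
  then have L: "L \<ge> 1" using n by (simp add: L_def ln_ge_iff)
  have T: "T > 0" "real T > 40 * L" "real T \<le> 41 * L" using L unfolding T_def by linarith+
  have K: "real K \<ge> L" "real K \<le> 2 * L" using L unfolding K_def by linarith+
  have KT: "real (K * T) \<le> 82 * L\<^sup>2"
    using mult_mono[OF K(2) T(3)] L by (simp add: power2_eq_square)
  obtain strat where bis: "\<And>h. bisection n (strat h)"
    and tar: "\<forall>h. \<exists>S. target n h S \<and> S \<subseteq> strat h"
    using ex_cut_strategy[OF n(2)] by blast
  let ?strat = "\<lambda>h. strat (drop (length h div T * T) h)"
  have "eulerian n (union_graph n ms) \<and> 1/16 * ln (real n) \<le> edge_expansion n (union_graph n ms)"
    if len: "length ms = K * T"
      and ms: "\<forall>i<K * T. directed_matching n (?strat (take i ms)) (ms ! i)" for ms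
  proof -
    have bij: "\<forall>\<sigma>\<in>set ms. bij_betw \<sigma> {..<n} {..<n}"
      using ms len by (auto simp: in_set_conv_nth directed_matching_def)
    have "expanding n ms (K * (1/16))"
      using n T by (intro repeated_strategy_expanding[OF T(1) _ len ms]
          cut_strategy_expanding[OF _ _ tar]) (auto simp: L_def)
    then have "K * (1/16) \<le> edge_expansion n (union_graph n ms)"
      using n by (intro edge_expansion_ge[OF bij]) auto
    then show ?thesis using K eulerian_union_graph[OF bij] by (simp add: L_def)
  qed
  then show "\<exists>T::nat. real T \<le> 82 * (ln (real n))^2 \<and>
        (\<exists>strat :: (nat \<Rightarrow> nat) list \<Rightarrow> nat set.
           (\<forall>h. bisection n (strat h)) \<and>
           (\<forall>ms :: (nat \<Rightarrow> nat) list.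
              length ms = T \<and> (\<forall>i<T. directed_matching n (strat (take i ms)) (ms ! i)) \<longrightarrow>
              eulerian n (union_graph n ms) \<and>
              edge_expansion n (union_graph n ms) \<ge> 1/16 * ln (real n)))"
    using KT bis by (intro exI[of _ "K * T"] conjI exI[of _ ?strat]) (simp_all only: L_def, blast+)
qed auto

end
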